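(* Let $t$ and $d$ be positive integers and let $k$ be an integer with $0\le k\le d-1$. Let $\mathcal{P}_t$ be the set of $t$-core partitions, and for a positive integer $u$ let ${}_{d}\mathcal{P}_{u}$ be the set of $u$-core partitions all of whose parts are multiples of $d$. Then there is a bijection $\Psi:\mathcal{P}_t\to {}_{d}\mathcal{P}_{dt-k}$ such that $\#(\Psi(\lambda))=\#(\lambda)$ for every $\lambda\in\mathcal{P}_t$.
   Context: A partition is a finite nonincreasing sequence $\lambda=(\lambda_1,\dots,\lambda_l)$ of positive integers (its parts); $\#(\lambda)=l$ is the number of parts. The empty partition is allowed and is a $t$-core for every $t$ (and belongs to ${}_{d}\mathcal{P}_u$). The Ferrers diagram of $\lambda$ has $\lambda_j$ nodes in row $j$ (left justified). The hook length of a node is the number of nodes consisting of the node itself, the nodes to its right in the same row and the nodes below it in the same column. $\lambda$ is a $t$-core partition if no node has hook length $t$ (equivalently, no hook length is divisible by $t$). *)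

theory Defs imports Main begin

definition is_partition :: "nat list \<Rightarrow> bool" where
  "is_partition p \<longleftrightarrow> sorted_wrt (\<ge>) p \<and> (\<forall>x\<in>set p. 0 < x)"

text \<open>Rows and columns of the Ferrers diagram are numbered from 0; the node \<open>(i, j)\<close> lies in
  row \<open>i\<close> and column \<open>j\<close>, and row indices increase downwards.\<close>

definition ferrers :: "nat list \<Rightarrow> (nat \<times> nat) set" where
  "ferrers p = {(i, j). i < length p \<and> j < p ! i}"

definition hook :: "nat list \<Rightarrow> nat \<times> nat \<Rightarrow> (nat \<times> nat) set" where
  "hook p = (\<lambda>(i, j). {(i', j') \<in> ferrers p. (i' = i \<and> j \<le> j') \<or> (j' = j \<and> i \<le> i')})"

definition hook_length :: "nat list \<Rightarrow> nat \<times> nat \<Rightarrow> nat" where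
  "hook_length p v = card (hook p v)"

definition t_cores :: "nat \<Rightarrow> nat list set" where
  "t_cores t = {p. is_partition p \<and> (\<forall>v\<in>ferrers p. hook_length p v \<noteq> t)}"

definition multiple_cores :: "nat \<Rightarrow> nat \<Rightarrow> nat list set" where
  "multiple_cores d u = {p \<in> t_cores u. \<forall>x\<in>set p. d dvd x}"

end

theory Submission imports Defs begin

text \<open>
  A partition with \<open>l\<close> parts is encoded by its set of \<^emph>\<open>beads\<close>: the hook lengths of its first
  column, an \<open>l\<close>-element set of positive integers.  The part belonging to a bead is the
  number of gaps (non-beads) below it, and the hook lengths in its row are the distances down to
  these gaps.  So all parts are multiples of \<open>d\<close> iff \<open>d\<close> divides the number of gaps below each
  bead, and the partition is a \<open>u\<close>-core iff a bead \<open>x \<ge> u\<close> always has another bead at \<open>x - u\<close>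
  (lemmas \<open>set_eq_gaps_beads\<close> and \<open>core_iff_beads\<close>).

  For \<open>u = d * t - k\<close> the sets with these two properties are counted by a Pascal recurrence in
  which \<open>d\<close> and \<open>k\<close> do not appear.  It is best to allow \<open>0\<close> as a bead.  If \<open>0\<close> is a bead, drop
  it and shift the others down: \<open>l\<close> decreases by one.  If \<open>0\<close> is not a bead, the gaps
  below the first bead number at least \<open>d\<close>; by the core condition no bead is then congruent to
  any of \<open>0, \<dots>, d - 1\<close> modulo \<open>u\<close>.  Deleting these \<open>d\<close> residue classes from the number line
  turns the modulus \<open>u\<close> into \<open>u - d = d * (t - 1) - k\<close>, so \<open>t\<close> decreases by one; the
  number of gaps below a bead changes only by a multiple of \<open>d\<close>.  For \<open>t = 1\<close> there is nothing
  left, because \<open>u \<le> d\<close>; this is where \<open>0 \<le> k < d\<close> enters.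

  Hence there are \<open>l + t - 2 choose l\<close> partitions with \<open>l\<close> parts in \<open>multiple_cores d (d * t - k)\<close>.
  The \<open>t\<close>-cores are the case \<open>d = 1\<close>, \<open>k = 0\<close>, so both families have equally many
  members of each length, and bijections between the finite sets of members of equal length
  combine to \<open>\<Psi>\<close>.
\<close>

section \<open>Bead sets\<close>

definition gaps :: "nat set \<Rightarrow> nat \<Rightarrow> nat" where
  "gaps S x = card ({..<x} - S)"

definition bead_sets :: "nat \<Rightarrow> nat \<Rightarrow> nat \<Rightarrow> nat set set" where
  "bead_sets d u l = {S. finite S \<and> card S = l \<and> (\<forall>x\<in>S. u \<le> x \<longrightarrow> x - u \<in> S) \<and> (\<forall>x\<in>S. d dvd gaps S x)}"

lemma gaps_plus_card: "gaps S x + card (S \<inter> {..<x}) = x"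
proof -
  have "card ({..<x} - S) + card (S \<inter> {..<x}) = card (({..<x} - S) \<union> (S \<inter> {..<x}))"
    by (rule card_Un_disjoint[symmetric]) auto
  also have "({..<x} - S) \<union> (S \<inter> {..<x}) = {..<x}" by auto
  finally show ?thesis by (simp add: gaps_def)
qed

lemma bead_sets_0: "bead_sets d u 0 = {{}}"
  by (auto simp: bead_sets_def)

text \<open>By the core condition, any bead forces a bead in its residue class below \<open>u\<close>.\<close>

lemma mod_mem_bead_set:
  assumes S: "S \<in> bead_sets d u l" and "x \<in> S"
  shows "x mod u \<in> S"
  using \<open>x \<in> S\<close>
proof (induction x rule: less_induct)
  case (less x)
  show ?case
  proof (cases "0 < u \<and> u \<le> x")
    case True
    then have "x - u \<in> S" using S less.prems by (simp add: bead_sets_def)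
    with less.IH[of "x - u"] True show ?thesis by (simp add: le_mod_geq)
  next
    case False
    with less.prems show ?thesis by (cases "u = 0") auto
  qed
qed

text \<open>Everything below the least bead is a gap, so the least bead is a positive multiple of \<open>d\<close>.\<close>

lemma least_bead_ge:
  assumes S: "S \<in> bead_sets d u l" and "0 \<notin> S" and "x \<in> S"
  shows "d \<le> x"
proof -
  have fin: "finite S" using S by (simp add: bead_sets_def)
  define m where "m = Min S"
  have m: "m \<in> S" "m \<le> x"
    unfolding m_def using fin \<open>x \<in> S\<close> by (blast intro: Min_in Min_le)+
  have "S \<inter> {..<m} = {}" using fin unfolding m_def by (auto dest: Min_le leD)
  then have "gaps S m = m" using gaps_plus_card[of S m] by simp
  then have "d dvd m" using S m by (force simp: bead_sets_def)
  moreover have "0 < m" using m \<open>0 \<notin> S\<close> by (cases m) auto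
  ultimately show ?thesis using m dvd_imp_le[of d m] by linarith
qed

section \<open>Adding the bead 0\<close>

definition push :: "nat set \<Rightarrow> nat set" where
  "push S = insert 0 (Suc ` S)"

lemma gaps_push: "gaps (push S) (Suc y) = gaps S y"
proof -
  have "{..<Suc y} - push S = Suc ` ({..<y} - S)"
    by (fastforce simp: push_def less_Suc_eq_0_disj)
  then show ?thesis by (simp add: gaps_def card_image)
qed

lemma push_mem_iff:
  assumes "0 < u"
  shows "push S \<in> bead_sets d u (Suc l) \<longleftrightarrow> S \<in> bead_sets d u l"
proof -
  have fin: "finite (push S) \<longleftrightarrow> finite S"
    by (simp add: push_def finite_image_iff)
  have card: "finite S \<Longrightarrow> card (push S) = Suc (card S)"
    by (simp add: push_def card_image)
  have "Suc y - u \<in> push S \<longleftrightarrow> y - u \<in> S" if "u \<le> y" for y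
    using that by (auto simp: push_def Suc_diff_le)
  moreover have "Suc y - u \<in> push S" if "u \<le> Suc y" "\<not> u \<le> y" for y
    using that by (simp add: push_def)
  ultimately have core: "(\<forall>x\<in>push S. u \<le> x \<longrightarrow> x - u \<in> push S) \<longleftrightarrow> (\<forall>y\<in>S. u \<le> y \<longrightarrow> y - u \<in> S)"
    using assms unfolding push_def
    by (smt (verit) image_iff insert_iff le_SucI not_less)
  have "gaps (push S) 0 = 0" by (simp add: gaps_def)
  then have gap: "(\<forall>x\<in>push S. d dvd gaps (push S) x) \<longleftrightarrow> (\<forall>y\<in>S. d dvd gaps S y)"
    using gaps_push[of S] by (simp add: push_def)
  show ?thesis unfolding bead_sets_def using fin card core gap by auto
qed

lemma inj_push: "inj push"
proof
  fix S T assume "push S = push T"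
  then have "Suc ` S = Suc ` T" by (auto simp: push_def)
  then show "S = T" by (simp add: inj_image_eq_iff)
qed

lemma push_image_bead_sets:
  assumes "0 < u"
  shows "push ` bead_sets d u l = {S \<in> bead_sets d u (Suc l). 0 \<in> S}"
proof (intro equalityI subsetI)
  fix S assume "S \<in> push ` bead_sets d u l"
  then show "S \<in> {S \<in> bead_sets d u (Suc l). 0 \<in> S}"
    using push_mem_iff[OF assms] by (auto simp: push_def)
next
  fix S assume S: "S \<in> {S \<in> bead_sets d u (Suc l). 0 \<in> S}"
  have "S = push {y. Suc y \<in> S}"
  proof (rule set_eqI)
    fix x show "x \<in> S \<longleftrightarrow> x \<in> push {y. Suc y \<in> S}"
      using S by (cases x) (auto simp: push_def)
  qed
  with S push_mem_iff[OF assms] show "S \<in> push ` bead_sets d u l" by fastforce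
qed

section \<open>Inserting empty residue classes\<close>

text \<open>The increasing enumeration of the numbers whose residue modulo \<open>v + d\<close> is at least \<open>d\<close>:
  each block of \<open>v\<close> consecutive numbers is preceded by \<open>d\<close> new ones.\<close>

definition spread :: "nat \<Rightarrow> nat \<Rightarrow> nat \<Rightarrow> nat" where
  "spread d v y = y + d * (y div v + 1)"

lemma strict_mono_spread: "strict_mono (spread d v)"
  by (rule strict_monoI) (auto simp: spread_def intro!: add_less_le_mono mult_le_mono2 div_le_mono)

lemma inj_spread: "inj (spread d v)"
  using strict_mono_spread by (rule strict_mono_imp_inj_on)

lemma spread_minus:
  assumes "0 < v" and "v \<le> y"
  shows "spread d v y = spread d v (y - v) + (v + d)"
  using assms by (simp add: spread_def le_div_geq)

lemma spread_less:
  assumes "y < v"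
  shows "spread d v y < v + d"
  using assms by (simp add: spread_def)

lemma mem_range_spread:
  assumes "0 < v" and "d \<le> x mod (v + d)"
  shows "x \<in> range (spread d v)"
proof -
  define q r where "q = x div (v + d)" and "r = x mod (v + d)"
  have x: "x = (v + d) * q + r" by (simp add: q_def r_def)
  have r: "r < v + d" using assms by (simp add: r_def)
  have "r - d < v" using r assms by linarith
  then have "(v * q + (r - d)) div v = q" by simp
  then have "spread d v (v * q + (r - d)) = x"
    using assms(2)[folded r_def] unfolding spread_def x by (simp add: algebra_simps)
  then show ?thesis by blast
qed

lemma gaps_spread:
  "gaps (spread d v ` S) (spread d v y) = gaps S y + d * (y div v + 1)"
proof -
  have "spread d v ` S \<inter> {..<spread d v y} = spread d v ` (S \<inter> {..<y})"
    using strict_mono_less[OF strict_mono_spread] by auto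
  then have "card (spread d v ` S \<inter> {..<spread d v y}) = card (S \<inter> {..<y})"
    by (simp add: card_image inj_on_subset[OF inj_spread])
  then show ?thesis
    using gaps_plus_card[of "spread d v ` S" "spread d v y"] gaps_plus_card[of S y]
    unfolding spread_def by linarith
qed

text \<open>A step down by \<open>v + d\<close> among the spread positions is a step down by \<open>v\<close> among the original
  ones, and the numbers of gaps below beads grow by multiples of \<open>d\<close>.\<close>

lemma spread_mem_iff:
  assumes "0 < v"
  shows "spread d v ` S \<in> bead_sets d (v + d) l \<longleftrightarrow> S \<in> bead_sets d v l"
proof -
  have fin: "finite (spread d v ` S) \<longleftrightarrow> finite S"
    by (simp add: finite_image_iff inj_on_subset[OF inj_spread])
  have card: "card (spread d v ` S) = card S"
    by (simp add: card_image inj_on_subset[OF inj_spread])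
  have "(v + d \<le> spread d v y \<longrightarrow> spread d v y - (v + d) \<in> spread d v ` S)
      \<longleftrightarrow> (v \<le> y \<longrightarrow> y - v \<in> S)" for y
  proof (cases "v \<le> y")
    case True
    then show ?thesis
      using spread_minus[OF assms True, of d] by (simp add: inj_image_mem_iff[OF inj_spread])
  next
    case False
    then show ?thesis using spread_less[of y v d] by simp
  qed
  then have core: "(\<forall>x\<in>spread d v ` S. v + d \<le> x \<longrightarrow> x - (v + d) \<in> spread d v ` S)
      \<longleftrightarrow> (\<forall>y\<in>S. v \<le> y \<longrightarrow> y - v \<in> S)"
    by simp
  have gap: "(\<forall>x\<in>spread d v ` S. d dvd gaps (spread d v ` S) x) \<longleftrightarrow> (\<forall>y\<in>S. d dvd gaps S y)"
    unfolding ball_simps gaps_spread by (simp only: dvd_add_left_iff dvd_triv_left)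
  show ?thesis unfolding bead_sets_def using fin card core gap by simp
qed

text \<open>If \<open>0\<close> is not a bead, then no number below \<open>d\<close> is, and hence no number whose residue
  modulo \<open>v + d\<close> is below \<open>d\<close>: all beads lie in the range of \<open>spread\<close>.\<close>

lemma spread_image_bead_sets:
  assumes "0 < v" and "0 < d"
  shows "image (spread d v) ` bead_sets d v l = {S \<in> bead_sets d (v + d) l. 0 \<notin> S}"
proof (intro equalityI subsetI)
  fix S assume "S \<in> image (spread d v) ` bead_sets d v l"
  then show "S \<in> {S \<in> bead_sets d (v + d) l. 0 \<notin> S}"
    using spread_mem_iff[OF assms(1)] assms(2) by (auto simp: spread_def)
next
  fix S assume S: "S \<in> {S \<in> bead_sets d (v + d) l. 0 \<notin> S}"
  have "S \<subseteq> range (spread d v)"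
  proof
    fix x assume "x \<in> S"
    then have "d \<le> x mod (v + d)"
      using S least_bead_ge mod_mem_bead_set by blast
    then show "x \<in> range (spread d v)" by (rule mem_range_spread[OF assms(1)])
  qed
  then obtain T where "S = spread d v ` T" by (auto simp: subset_image_iff)
  with S show "S \<in> image (spread d v) ` bead_sets d v l"
    using spread_mem_iff[OF assms(1)] by auto
qed

section \<open>Counting bead sets\<close>

lemma bead_sets_Suc:
  assumes "0 < u"
  shows "bead_sets d u (Suc l) = push ` bead_sets d u l \<union> {S \<in> bead_sets d u (Suc l). 0 \<notin> S}"
    and "push ` bead_sets d u l \<inter> {S \<in> bead_sets d u (Suc l). 0 \<notin> S} = {}"
  using push_image_bead_sets[OF assms, of d l] by auto

text \<open>The two cases, bead \<open>0\<close> present or absent, give the Pascal recurrence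
  \<open>a (t + 1) (l + 1) = a (t + 1) l + a t (l + 1)\<close>.  At \<open>t = 0\<close> (modulus \<open>d - k \<le> d\<close>) the second
  case is empty for \<open>l > 0\<close>, since a residue modulo \<open>d - k\<close> cannot reach \<open>d\<close>.\<close>

lemma card_bead_sets:
  assumes "k < d"
  shows "finite (bead_sets d (d * Suc t - k) l) \<and> card (bead_sets d (d * Suc t - k) l) = l + t choose l"
proof (induction t arbitrary: l)
  case 0
  have u: "0 < d * Suc 0 - k" using assms by simp
  show ?case
  proof (induction l)
    case 0
    show ?case by (simp add: bead_sets_0)
  next
    case (Suc l)
    have False if "S \<in> bead_sets d (d - k) (Suc l)" "0 \<notin> S" for S
    proof -
      have "S \<noteq> {}" using that by (auto simp: bead_sets_def)
      then obtain x where "x \<in> S" by blast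
      then have "d \<le> x mod (d - k)"
        using that least_bead_ge mod_mem_bead_set by blast
      moreover have "x mod (d - k) < d - k" using assms by simp
      ultimately show False by linarith
    qed
    then have "bead_sets d (d * Suc 0 - k) (Suc l) = push ` bead_sets d (d * Suc 0 - k) l"
      unfolding push_image_bead_sets[OF u] by auto
    then show ?case
      using Suc.IH by (simp add: card_image inj_on_subset[OF inj_push])
  qed
next
  case (Suc t)
  have u: "0 < d * Suc t - k" "0 < d * Suc (Suc t) - k" using assms by (auto simp: trans_less_add1)
  have eq: "d * Suc (Suc t) - k = (d * Suc t - k) + d"
    using assms by (simp add: trans_less_add1 less_imp_le)
  have d: "0 < d" using assms by simp
  note outer = Suc.IH
  show ?case
  proof (induction l)
    case 0
    show ?case by (simp add: bead_sets_0)
  next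
    case (Suc l)
    let ?A = "bead_sets d (d * Suc (Suc t) - k)"
    let ?B = "{S \<in> ?A (Suc l). 0 \<notin> S}"
    have B: "?B = image (spread d (d * Suc t - k)) ` bead_sets d (d * Suc t - k) (Suc l)"
      using spread_image_bead_sets[OF u(1) d, of "Suc l"] by (simp only: eq)
    have "inj (image (spread d (d * Suc t - k)))"
      using inj_spread by (simp add: inj_def inj_image_eq_iff)
    then have cB: "finite ?B \<and> card ?B = Suc l + t choose Suc l"
      unfolding B using outer[of "Suc l"] by (simp add: card_image inj_on_subset)
    have cP: "finite (push ` ?A l) \<and> card (push ` ?A l) = l + Suc t choose l"
      using Suc.IH by (simp add: card_image inj_on_subset[OF inj_push])
    have "finite (?A (Suc l))"
      using cB cP by (subst bead_sets_Suc(1)[OF u(2)]) (intro finite_UnI; blast)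
    moreover have "card (?A (Suc l)) = card (push ` ?A l) + card ?B"
      using bead_sets_Suc[OF u(2), of d l] cB cP card_Un_disjoint[of "push ` ?A l" ?B]
      by simp
    ultimately show ?case using cB cP by simp
  qed
qed

text \<open>The truncated subtraction in \<open>l + t - 2\<close> is harmless: it only matters for \<open>l = 0\<close>, \<open>t = 1\<close>,
  where both sides are 1.\<close>

lemma card_bead_sets_without_0:
  assumes "k < d" and "0 < t"
  shows "finite {S \<in> bead_sets d (d * t - k) l. 0 \<notin> S}"
    and "card {S \<in> bead_sets d (d * t - k) l. 0 \<notin> S} = l + t - 2 choose l"
proof -
  obtain s where t: "t = Suc s" using assms(2) by (cases t) auto
  note c = card_bead_sets[OF assms(1), of s, folded t]
  let ?A = "bead_sets d (d * t - k)"
  show "finite {S \<in> ?A l. 0 \<notin> S}" using c[of l] by simp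
  show "card {S \<in> ?A l. 0 \<notin> S} = l + t - 2 choose l"
  proof (cases l)
    case 0
    have "{S \<in> ?A l. 0 \<notin> S} = {{}}" by (auto simp: 0 bead_sets_0)
    then show ?thesis by (simp add: 0)
  next
    case (Suc n)
    have u: "0 < d * t - k" using assms by (auto simp: t trans_less_add1)
    have "card (push ` ?A n) = n + s choose n"
      using c[of n] by (simp add: card_image inj_on_subset[OF inj_push])
    moreover have "card (?A (Suc n)) = card (push ` ?A n) + card {S \<in> ?A (Suc n). 0 \<notin> S}"
      using bead_sets_Suc[OF u, of d n] c[of n] c[of "Suc n"]
        card_Un_disjoint[of "push ` ?A n" "{S \<in> ?A (Suc n). 0 \<notin> S}"] by simp
    ultimately show ?thesis using c[of "Suc n"] by (simp add: Suc t)
  qed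
qed

section \<open>The beads of a partition\<close>

fun beads :: "nat list \<Rightarrow> nat set" where
  "beads [] = {}"
| "beads (x # xs) = insert (x + length xs) (beads xs)"

lemma is_partition_Nil: "is_partition []"
  by (simp add: is_partition_def)

lemma is_partition_Cons:
  "is_partition (x # xs) \<longleftrightarrow> 0 < x \<and> (\<forall>y\<in>set xs. y \<le> x) \<and> is_partition xs"
  by (auto simp: is_partition_def)

lemma beads_less:
  "\<forall>y\<in>set xs. y \<le> x \<Longrightarrow> b \<in> beads xs \<Longrightarrow> b < x + length xs"
  by (induction xs) auto

lemma beads_less_first:
  "is_partition (x # xs) \<Longrightarrow> b \<in> beads xs \<Longrightarrow> b < x + length xs"
  by (rule beads_less) (auto simp: is_partition_Cons)

lemma finite_beads: "finite (beads p)"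
  by (induction p) auto

lemma card_beads: "is_partition p \<Longrightarrow> card (beads p) = length p"
proof (induction p)
  case (Cons x xs)
  have "x + length xs \<notin> beads xs" using beads_less_first[OF Cons.prems] by blast
  with Cons show ?case by (simp add: is_partition_Cons finite_beads)
qed simp

lemma zero_notin_beads: "is_partition p \<Longrightarrow> 0 \<notin> beads p"
  by (induction p) (auto simp: is_partition_Cons)

lemma gaps_beads_first:
  assumes "is_partition (x # xs)"
  shows "gaps (beads (x # xs)) (x + length xs) = x"
proof -
  have "beads (x # xs) \<inter> {..<x + length xs} = beads xs"
    using beads_less_first[OF assms] by auto
  then show ?thesis
    using gaps_plus_card[of "beads (x # xs)" "x + length xs"] card_beads[of xs] assms
    by (simp add: is_partition_Cons)
qed

lemma set_eq_gaps_beads: "is_partition p \<Longrightarrow> set p = gaps (beads p) ` beads p"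
proof (induction p)
  case (Cons x xs)
  have "gaps (beads (x # xs)) b = gaps (beads xs) b" if "b \<in> beads xs" for b
  proof -
    have "{..<b} - beads (x # xs) = {..<b} - beads xs"
      using beads_less_first[OF Cons.prems that] by auto
    then show ?thesis by (simp add: gaps_def)
  qed
  then have "gaps (beads (x # xs)) ` beads xs = set xs"
    using Cons by (simp add: is_partition_Cons)
  then show ?case using gaps_beads_first[OF Cons.prems] by simp
qed simp

lemma beads_inject:
  "is_partition p \<Longrightarrow> is_partition q \<Longrightarrow> beads p = beads q \<Longrightarrow> p = q"
proof (induction p arbitrary: q)
  case Nil
  then show ?case by (cases q) auto
next
  case (Cons x xs)
  then obtain y ys where q: "q = y # ys" by (cases q) auto
  have less: "\<forall>b\<in>beads xs. b < x + length xs" "\<forall>b\<in>beads ys. b < y + length ys"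
    using beads_less_first Cons.prems unfolding q by blast+
  have eq: "insert (x + length xs) (beads xs) = insert (y + length ys) (beads ys)"
    using Cons.prems q by simp
  have max: "x + length xs = y + length ys"
    using eq less by (metis insert_iff less_asym)
  have "beads xs = beads ys"
    using eq less unfolding max by (metis insert_ident less_irrefl)
  then have "xs = ys"
    using Cons.IH Cons.prems q by (simp add: is_partition_Cons)
  with max q show ?case by simp
qed

lemma beads_surj:
  assumes "finite S" and "0 \<notin> S"
  shows "\<exists>p. is_partition p \<and> beads p = S"
  using assms
proof (induction S rule: finite_linorder_max_induct)
  case empty
  then show ?case using is_partition_Nil by force
next
  case (insert m S)
  then obtain p where p: "is_partition p" "beads p = S" by auto
  define x where "x = m - length p"
  have "length p \<le> m \<and> 0 < m - length p \<and> (\<forall>y\<in>set p. y \<le> m - length p)"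
  proof (cases p)
    case Nil
    then show ?thesis using insert.prems by auto
  next
    case (Cons y ys)
    then have "y + length ys < m" using insert.hyps p by auto
    moreover have "0 < y" "\<forall>z\<in>set ys. z \<le> y" using p Cons by (auto simp: is_partition_Cons)
    ultimately show ?thesis by (auto simp: Cons)
  qed
  then have "is_partition (x # p) \<and> beads (x # p) = insert m S"
    using p by (simp add: x_def is_partition_Cons)
  then show ?case by blast
qed

section \<open>Hook lengths as distances from beads to gaps\<close>

lemma hook_length_first_row:
  assumes "j < x"
  shows "hook_length (x # xs) (0, j) = (x - j) + length (filter (\<lambda>y. j < y) xs)"
proof -
  let ?R = "Pair (0::nat) ` {j..<x}"
  let ?C = "(\<lambda>i. (Suc i, j)) ` {i. i < length xs \<and> j < xs ! i}"
  have "hook (x # xs) (0, j) = ?R \<union> ?C"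
    unfolding hook_def ferrers_def using assms
    by (auto simp: image_iff nth_Cons less_Suc_eq_0_disj split: nat.splits)
  moreover have "card (?R \<union> ?C) = card ?R + card ?C"
    by (rule card_Un_disjoint) auto
  moreover have "card ?R = x - j" by (simp add: card_image inj_on_def)
  moreover have "card ?C = length (filter (\<lambda>y. j < y) xs)"
    by (simp add: card_image inj_on_def length_filter_conv_card)
  ultimately show ?thesis by (simp add: hook_length_def)
qed

lemma hook_length_other_row: "hook_length (x # xs) (Suc i, j) = hook_length xs (i, j)"
proof -
  have "hook (x # xs) (Suc i, j) = (\<lambda>(a, b). (Suc a, b)) ` hook xs (i, j)"
    unfolding hook_def ferrers_def
    by (auto simp: image_iff nth_Cons less_Suc_eq_0_disj split: nat.splits)
  then show ?thesis
    by (simp add: hook_length_def card_image inj_on_def split_def prod_eq_iff)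
qed

lemma ball_ferrers_Cons:
  "(\<forall>v\<in>ferrers (x # xs). P v) \<longleftrightarrow> (\<forall>j<x. P (0, j)) \<and> (\<forall>(i, j)\<in>ferrers xs. P (Suc i, j))"
  unfolding ferrers_def by (auto simp: less_Suc_eq_0_disj)

lemma gap_notin_beads:
  "is_partition xs \<Longrightarrow> j + length (filter (\<lambda>y. y \<le> j) xs) \<notin> beads xs"
proof (induction xs)
  case (Cons y ys)
  note IH = Cons.IH and part = Cons.prems
  show ?case
  proof (cases "y \<le> j")
    case True
    then have "filter (\<lambda>y. y \<le> j) ys = ys"
      using part by (intro filter_True) (auto simp: is_partition_Cons)
    with True show ?thesis using beads_less_first[OF part] by fastforce
  next
    case False
    have "length (filter (\<lambda>y. y \<le> j) ys) \<le> length ys" by simp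
    with False have "j + length (filter (\<lambda>y. y \<le> j) ys) < y + length ys" by linarith
    with False show ?thesis using IH part by (simp add: is_partition_Cons)
  qed
qed simp

text \<open>Walking along the boundary of the diagram, the horizontal step in column \<open>j\<close> comes after
  \<open>j\<close> earlier horizontal steps and after the vertical steps of the parts \<open>\<le> j\<close>.  That these
  positions are all the gaps follows by counting: they are distinct, and there are \<open>x\<close> of them.\<close>

lemma gaps_as_columns:
  assumes "is_partition xs" and "\<forall>y\<in>set xs. y \<le> x"
  shows "(\<lambda>j. j + length (filter (\<lambda>y. y \<le> j) xs)) ` {..<x} = {..<x + length xs} - beads xs"
    (is "?g ` _ = ?G")
proof (rule card_subset_eq)
  have "length (filter (\<lambda>y. y \<le> i) xs) \<le> length (filter (\<lambda>y. y \<le> j) xs)" if "i \<le> j" for i j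
    using that by (induction xs) auto
  then have "strict_mono ?g" by (intro strict_monoI add_less_le_mono) auto
  then have "card (?g ` {..<x}) = x" by (simp add: card_image strict_mono_imp_inj_on)
  moreover have "card ?G = x"
  proof -
    have "beads xs \<inter> {..<x + length xs} = beads xs" using beads_less[OF assms(2)] by auto
    then show ?thesis
      using gaps_plus_card[of "beads xs" "x + length xs"] card_beads[OF assms(1)]
      by (simp add: gaps_def)
  qed
  ultimately show "card (?g ` {..<x}) = card ?G" by simp
  show "finite ?G" by simp
  show "?g ` {..<x} \<subseteq> ?G"
    using gap_notin_beads[OF assms(1)] by (auto intro!: add_less_le_mono)
qed

text \<open>The hook length of the node in column \<open>j\<close> of the first row is the distance from the first
  bead \<open>x + length xs\<close> down to the gap of column \<open>j\<close>: between them lie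
  the \<open>x - j\<close> horizontal steps of the node and its arm and the vertical steps of the parts \<open>> j\<close>,
  which form its leg.\<close>

lemma first_row_avoids_iff:
  assumes "is_partition (x # xs)" and "0 < u"
  shows "(\<forall>j<x. hook_length (x # xs) (0, j) \<noteq> u)
    \<longleftrightarrow> (u \<le> x + length xs \<longrightarrow> x + length xs - u \<in> beads xs)"
proof -
  let ?m = "x + length xs"
  let ?g = "\<lambda>j. j + length (filter (\<lambda>y. y \<le> j) xs)"
  have h: "hook_length (x # xs) (0, j) + ?g j = ?m" if "j < x" for j
  proof -
    have "length (filter (\<lambda>y. j < y) xs) + length (filter (\<lambda>y. y \<le> j) xs) = length xs"
      using sum_length_filter_compl[of "\<lambda>y. j < y" xs] by (simp add: not_less)
    with that show ?thesis by (simp add: hook_length_first_row)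
  qed
  have G: "?g ` {..<x} = {..<?m} - beads xs"
    using assms(1) by (intro gaps_as_columns) (auto simp: is_partition_Cons)
  have "(\<exists>j<x. hook_length (x # xs) (0, j) = u) \<longleftrightarrow> u \<le> ?m \<and> ?m - u \<in> ?g ` {..<x}"
  proof
    assume "\<exists>j<x. hook_length (x # xs) (0, j) = u"
    then obtain j where "j < x" "u + ?g j = ?m" using h by blast
    then have "u \<le> ?m" "?m - u = ?g j" by linarith+
    with \<open>j < x\<close> show "u \<le> ?m \<and> ?m - u \<in> ?g ` {..<x}" by blast
  next
    assume "u \<le> ?m \<and> ?m - u \<in> ?g ` {..<x}"
    then obtain j where "u \<le> ?m" "j < x" "?m - u = ?g j" by blast
    with h[of j] show "\<exists>j<x. hook_length (x # xs) (0, j) = u"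
      by (intro exI[of _ j]) linarith
  qed
  then show ?thesis unfolding G using assms(2) by auto
qed

text \<open>Removing the first row does not change the other hooks, so the first-row criterion can be
  applied row by row.  The removed bead is the largest one and never of the form \<open>b - u\<close>.\<close>

lemma core_iff_beads:
  assumes "is_partition p" and "0 < u"
  shows "(\<forall>v\<in>ferrers p. hook_length p v \<noteq> u) \<longleftrightarrow> (\<forall>b\<in>beads p. u \<le> b \<longrightarrow> b - u \<in> beads p)"
  using assms(1)
proof (induction p)
  case Nil
  then show ?case by (simp add: ferrers_def)
next
  case (Cons x xs)
  let ?m = "x + length xs"
  have "b - u \<noteq> ?m" if "b \<in> beads (x # xs)" "u \<le> b" for b
    using that beads_less_first[OF Cons.prems, of b] assms(2) by auto
  then have "(\<forall>b\<in>beads (x # xs). u \<le> b \<longrightarrow> b - u \<in> beads (x # xs))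
      \<longleftrightarrow> (u \<le> ?m \<longrightarrow> ?m - u \<in> beads xs) \<and> (\<forall>b\<in>beads xs. u \<le> b \<longrightarrow> b - u \<in> beads xs)"
    by auto
  moreover have "(\<forall>v\<in>ferrers xs. hook_length xs v \<noteq> u)
      \<longleftrightarrow> (\<forall>b\<in>beads xs. u \<le> b \<longrightarrow> b - u \<in> beads xs)"
    using Cons by (simp add: is_partition_Cons)
  moreover have "(\<forall>(i, j)\<in>ferrers xs. hook_length (x # xs) (Suc i, j) \<noteq> u)
      \<longleftrightarrow> (\<forall>v\<in>ferrers xs. hook_length xs v \<noteq> u)"
    by (auto simp: hook_length_other_row)
  ultimately show ?case
    using first_row_avoids_iff[OF Cons.prems assms(2)] unfolding ball_ferrers_Cons by blast
qed

lemma mem_multiple_cores_iff: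
  assumes "0 < u" and "is_partition p"
  shows "p \<in> multiple_cores d u \<longleftrightarrow> beads p \<in> bead_sets d u (length p)"
  using assms core_iff_beads[of p u] set_eq_gaps_beads[of p] card_beads[of p]
  by (simp add: multiple_cores_def t_cores_def bead_sets_def finite_beads)

lemma bij_betw_beads:
  assumes "0 < u"
  shows "bij_betw beads {p \<in> multiple_cores d u. length p = l} {S \<in> bead_sets d u l. 0 \<notin> S}"
proof (rule bij_betw_imageI)
  have part: "is_partition p" if "p \<in> multiple_cores d u" for p
    using that by (simp add: multiple_cores_def t_cores_def)
  show "inj_on beads {p \<in> multiple_cores d u. length p = l}"
    using part beads_inject by (auto intro: inj_onI)
  show "beads ` {p \<in> multiple_cores d u. length p = l} = {S \<in> bead_sets d u l. 0 \<notin> S}"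
  proof (intro equalityI subsetI)
    fix S assume "S \<in> beads ` {p \<in> multiple_cores d u. length p = l}"
    then show "S \<in> {S \<in> bead_sets d u l. 0 \<notin> S}"
      using part mem_multiple_cores_iff[OF assms] zero_notin_beads by auto
  next
    fix S assume S: "S \<in> {S \<in> bead_sets d u l. 0 \<notin> S}"
    then have "finite S" "card S = l" by (auto simp: bead_sets_def)
    then obtain p where p: "is_partition p" "beads p = S" using beads_surj S by blast
    then have "length p = l" using card_beads \<open>card S = l\<close> by auto
    then show "S \<in> beads ` {p \<in> multiple_cores d u. length p = l}"
      using p S mem_multiple_cores_iff[OF assms p(1)] by auto
  qed
qed

section \<open>Equinumerosity of cores\<close>

lemma card_multiple_cores:
  assumes "k < d" and "0 < t"
  shows "finite {p \<in> multiple_cores d (d * t - k). length p = l}"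
    and "card {p \<in> multiple_cores d (d * t - k). length p = l} = l + t - 2 choose l"
proof -
  have "d \<le> d * t" using assms(2) by simp
  then have "0 < d * t - k" using assms(1) by linarith
  note bij = bij_betw_beads[OF this, of d l]
  show "finite {p \<in> multiple_cores d (d * t - k). length p = l}"
    using bij_betw_finite[OF bij] card_bead_sets_without_0[OF assms] by simp
  show "card {p \<in> multiple_cores d (d * t - k). length p = l} = l + t - 2 choose l"
    using bij_betw_same_card[OF bij] card_bead_sets_without_0[OF assms] by simp
qed

lemma bij_betw_graded:
  assumes "\<And>n. \<exists>f. bij_betw f {x \<in> A. g x = n} {y \<in> B. h y = n}"
  shows "\<exists>F. bij_betw F A B \<and> (\<forall>x\<in>A. h (F x) = g x)"
proof -
  obtain f where f: "\<And>n. bij_betw (f n) {x \<in> A. g x = n} {y \<in> B. h y = n}"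
    using assms by metis
  define F where "F x = f (g x) x" for x
  have F: "F x \<in> B \<and> h (F x) = g x" if "x \<in> A" for x
    using bij_betwE[OF f[of "g x"]] that by (simp add: F_def)
  have "inj_on F A"
  proof (rule inj_onI)
    fix x y assume xy: "x \<in> A" "y \<in> A" "F x = F y"
    then have "g x = g y" using F by metis
    with xy show "x = y"
      using bij_betw_imp_inj_on[OF f[of "g y"]] by (simp add: F_def inj_on_def)
  qed
  moreover have "F ` A = B"
  proof (intro equalityI subsetI)
    fix y assume "y \<in> B"
    then have "y \<in> f (h y) ` {x \<in> A. g x = h y}"
      using bij_betw_imp_surj_on[OF f[of "h y"]] by simp
    then obtain x where "x \<in> A" "y = F x" by (auto simp: F_def)
    then show "y \<in> F ` A" by blast
  qed (use F in auto)
  ultimately show ?thesis using F by (auto simp: bij_betw_def)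
qed

theorem theorem2p7:
  fixes t d k :: nat
  assumes "0 < t" and "0 < d" and "k \<le> d - 1"
  shows "\<exists>\<Psi>. bij_betw \<Psi> (t_cores t) (multiple_cores d (d * t - k))
           \<and> (\<forall>p\<in>t_cores t. length (\<Psi> p) = length p)"
proof (rule bij_betw_graded)
  fix l
  have "k < d" using assms by linarith
  \<comment> \<open>The cardinality does not depend on \<open>d\<close> and \<open>k\<close>, and \<open>t\<close>-cores are the case \<open>d = 1\<close>, \<open>k = 0\<close>.\<close>
  have "t_cores t = multiple_cores 1 (1 * t - 0)" by (simp add: multiple_cores_def)
  then have "finite {p \<in> t_cores t. length p = l}"
    and "card {p \<in> t_cores t. length p = l} = l + t - 2 choose l"
    using card_multiple_cores[of 0 1 t l] assms(1) by simp_all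
  then show "\<exists>f. bij_betw f {p \<in> t_cores t. length p = l}
      {p \<in> multiple_cores d (d * t - k). length p = l}"
    using card_multiple_cores[OF \<open>k < d\<close> assms(1), of l]
    by (intro finite_same_card_bij) simp_all
qed

end
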